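(* For all integers $b$, $m\ge 0$ and $k\ge1$, and for any choice of the integers $c_b(p_ip_j)$ as described in the context, $$\varphi(b,m,k)=m-\sum_{i=1}^{k}F_{b,m}(p_i)+\sum_{j=2}^{k}F_{b,m}(2p_j)+\sum_{i=2}^{k-1}\sum_{j=i+1}^{k}\varphi\bigl(c_b(p_ip_j),\,F_{b,m}(p_ip_j),\,i-1\bigr).$$
   Context: $p_i$ denotes the $i$-th prime ($p_1=2$) and $P_k=p_1\cdots p_k$. For integers $b$, $m\ge0$, $d\ge1$, $F_{b,m}(d)$ is the number of integers $a$ with $b<a\le b+m$ and $d\mid a$. For integers $c$, $n\ge 0$, $t\ge1$, $\varphi(c,n,t)$ is the number of integers $a$ with $c<a\le c+n$ and $\gcd(a,P_t)=1$ (so $\varphi(c,0,t)=0$). For $2\le i<j$ and $d=p_ip_j$ (with $b,m$ fixed): if $F_{b,m}(d)\ge1$, let $y+d$ be the smallest integer in $\{b+1,\dots,b+m\}$ divisible by $d$; then $c_b(d)$ denotes an integer such that $\gcd(c_b(d)+x,P_{i-1})=\gcd(y+xd,P_{i-1})$ for all integers $x$ (such an integer exists). If $F_{b,m}(d)=0$, $c_b(d)$ is an arbitrary integer (the corresponding term is $0$). *)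

theory Defs
  imports "HOL-Number_Theory.Number_Theory" "HOL-Library.Infinite_Set"
begin

text \<open>Primes are indexed from 1, so \<open>nth_prime 1 = 2\<close>; the value at index 0 is junk.\<close>

definition nth_prime :: "nat \<Rightarrow> nat" where
  "nth_prime i = enumerate {p. prime p} (i - 1)"

definition primorial :: "nat \<Rightarrow> nat" where
  "primorial k = (\<Prod>i = 1..k. nth_prime i)"

definition F :: "int \<Rightarrow> nat \<Rightarrow> nat \<Rightarrow> nat" where
  "F b m d = card {a :: int. b < a \<and> a \<le> b + int m \<and> int d dvd a}"

definition phi :: "int \<Rightarrow> nat \<Rightarrow> nat \<Rightarrow> nat" where
  "phi c n t = card {a :: int. c < a \<and> a \<le> c + int n \<and> gcd a (int (primorial t)) = 1}"

definition first_multiple :: "int \<Rightarrow> nat \<Rightarrow> nat \<Rightarrow> int" where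
  "first_multiple b m d = Min {a \<in> {b + 1..b + int m}. int d dvd a}"

text \<open>
  The condition on the integer \<open>c\<close> to be an admissible value of \<open>c\<^sub>b(d)\<close> for
  \<open>d = p\<^sub>i p\<^sub>j\<close>. There is no constraint on \<open>c\<close> if the interval contains no multiple of \<open>d\<close>.
\<close>

definition admissible_shift :: "int \<Rightarrow> nat \<Rightarrow> nat \<Rightarrow> nat \<Rightarrow> int \<Rightarrow> bool" where
  "admissible_shift b m i j c \<longleftrightarrow>
     (let d = nth_prime i * nth_prime j; y = first_multiple b m d - int d
      in F b m d \<ge> 1 \<longrightarrow>
         (\<forall>x :: int. gcd (c + x) (int (primorial (i - 1)))
                   = gcd (y + x * int d) (int (primorial (i - 1)))))"

end

theory Submission
  imports Defs
begin

text \<open>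
  For a fixed integer \<open>a\<close> let \<open>q i\<close> be the indicator of \<open>p\<^sub>i\<close> dividing \<open>a\<close>. The product of
  \<open>1 - q l\<close> over \<open>l < i\<close> indicates that \<open>a\<close> is coprime to \<open>P\<^bsub>i-1\<^esub>\<close>, and telescoping this product
  twice expands the indicator of coprimality to \<open>P\<^sub>k\<close> into terms counting the primes dividing \<open>a\<close>
  and the pairs \<open>p\<^sub>i, p\<^sub>j\<close> of such primes with \<open>p\<^sub>i\<close> the smallest one. Summing over the interval
  gives the formula once the multiples of \<open>d = p\<^sub>i p\<^sub>j\<close> are parametrized as \<open>y + x d\<close>, where
  the shift \<open>c\<^sub>b(d)\<close> translates coprimality of \<open>y + x d\<close> into coprimality of \<open>c\<^sub>b(d) + x\<close>.
\<close>

text \<open>Each summand is the difference of the products up to \<open>i - 1\<close> and up to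
  \<open>i\<close>. For 0/1-valued \<open>q\<close> it singles out the least \<open>i\<close> with
  \<open>q i = 1\<close>.\<close>

lemma prod_one_minus_telescope:
  fixes q :: "nat \<Rightarrow> 'a :: comm_ring_1"
  shows "(\<Sum>i = 1..k. q i * (\<Prod>l = 1..i - 1. 1 - q l)) = 1 - (\<Prod>l = 1..k. 1 - q l)"
  by (induction k) (simp_all add: algebra_simps)

text \<open>By induction: the new factor changes the product by \<open>- q (Suc k) * ?z k\<close>,
  that is \<open>- q (Suc k) + q (Suc k) * (1 - ?z k)\<close>, and telescoping identifies the last
  term with the contribution of the new pairs \<open>(i, Suc k)\<close>.\<close>

lemma prod_one_minus_expand:
  fixes q :: "nat \<Rightarrow> 'a :: comm_ring_1"
  shows "(\<Prod>l = 1..k. 1 - q l) =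
    1 - (\<Sum>i = 1..k. q i) + (\<Sum>i = 1..k. \<Sum>j = i + 1..k. q i * q j * (\<Prod>l = 1..i - 1. 1 - q l))"
proof (induction k)
  case 0
  then show ?case by simp
next
  case (Suc k)
  let ?z = "\<lambda>i. \<Prod>l = 1..i. 1 - q l"
  let ?D = "\<lambda>n. \<Sum>i = 1..n. \<Sum>j = i + 1..n. q i * q j * ?z (i - 1)"
  \<comment> \<open>The outer index \<open>Suc k\<close> drops out because its inner sum is
    empty.\<close>
  have "?D (Suc k) = (\<Sum>i = 1..k. \<Sum>j = i + 1..Suc k. q i * q j * ?z (i - 1))"
    by simp
  also have "\<dots> = (\<Sum>i = 1..k. (\<Sum>j = i + 1..k. q i * q j * ?z (i - 1))
                      + q i * q (Suc k) * ?z (i - 1))"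
    by (intro sum.cong refl) simp
  also have "\<dots> = ?D k + q (Suc k) * (\<Sum>i = 1..k. q i * ?z (i - 1))"
    by (simp add: sum.distrib sum_distrib_left mult_ac)
  also have "\<dots> = ?D k + q (Suc k) * (1 - ?z k)"
    by (simp only: prod_one_minus_telescope)
  finally have D: "?D (Suc k) = ?D k + q (Suc k) * (1 - ?z k)" .
  have "?z (Suc k) = ?z k - q (Suc k) * ?z k"
    by (simp add: algebra_simps)
  also have "\<dots> = 1 - (\<Sum>i = 1..Suc k. q i) + ?D (Suc k)"
    unfolding D using Suc.IH by (simp add: algebra_simps)
  finally show ?case .
qed

lemma prime_nth_prime: "prime (nth_prime i)"
  using enumerate_in_set[OF primes_infinite] by (simp add: nth_prime_def)

lemma nth_prime_less: "1 \<le> i \<Longrightarrow> i < j \<Longrightarrow> nth_prime i < nth_prime j"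
  unfolding nth_prime_def by (rule enumerate_mono[OF _ primes_infinite]) simp

lemma nth_prime_1: "nth_prime 1 = 2"
  unfolding nth_prime_def by (simp add: enumerate_0, rule Least_equality)
    (auto intro: prime_ge_2_nat)

lemma nth_prime_mult_dvd_iff:
  assumes "1 \<le> i" "i < j"
  shows "int (nth_prime i * nth_prime j) dvd a \<longleftrightarrow>
    int (nth_prime i) dvd a \<and> int (nth_prime j) dvd a"
proof -
  have "coprime (nth_prime i) (nth_prime j)"
    using nth_prime_less[OF assms] by (intro primes_coprime prime_nth_prime) auto
  then have "coprime (int (nth_prime i)) (int (nth_prime j))"
    by simp
  then show ?thesis
    by (auto intro: divides_mult dest: dvd_mult_left dvd_mult_right)
qed

lemma coprime_primorial_iff:
  "gcd a (int (primorial t)) = 1 \<longleftrightarrow> (\<forall>l \<in> {1..t}. \<not> int (nth_prime l) dvd a)"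
proof -
  have "coprime a (int (nth_prime l)) \<longleftrightarrow> \<not> int (nth_prime l) dvd a" for l
    using prime_nth_prime[of l]
    by (metis coprime_commute not_prime_unit prime_imp_coprime coprime_absorb_left prime_nat_int_transfer)
  then have "coprime a (int (primorial t)) \<longleftrightarrow> (\<forall>l \<in> {1..t}. \<not> int (nth_prime l) dvd a)"
    by (induction t) (auto simp: primorial_def atLeastAtMostSuc_conv)
  then show ?thesis
    by (simp add: coprime_iff_gcd_eq_1)
qed

lemma of_bool_coprime_primorial:
  "of_bool (gcd a (int (primorial t)) = 1) =
    (\<Prod>l = 1..t. 1 - of_bool (int (nth_prime l) dvd a) :: int)"
  unfolding coprime_primorial_iff by (induction t) (auto simp: atLeastAtMostSuc_conv)

text \<open>Here \<open>y\<close> lies one step before the first multiple, so the index runs from 1,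
  just as \<open>phi\<close> counts from \<open>c + 1\<close>.\<close>

lemma multiples_eq_image:
  fixes b :: int
  assumes "d > 0" "F b m d \<ge> 1"
  defines "y \<equiv> first_multiple b m d - int d"
  shows "{a. b < a \<and> a \<le> b + int m \<and> int d dvd a} = (\<lambda>x. y + x * int d) ` {1..int (F b m d)}"
proof -
  define M where "M = {a. b < a \<and> a \<le> b + int m \<and> int d dvd a}"
  have M_eq: "M = {a \<in> {b + 1..b + int m}. int d dvd a}"
    by (auto simp: M_def)
  have fin: "finite M"
    unfolding M_eq by (rule finite_subset[of _ "{b + 1..b + int m}"]) auto
  have card: "F b m d = card M"
    by (simp add: F_def M_def)
  have ne: "M \<noteq> {}"
    using assms(2) card by auto
  have f: "first_multiple b m d = Min M"
    by (simp add: first_multiple_def M_eq)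
  have f_in: "y + int d \<in> M" and f_le: "\<And>a. a \<in> M \<Longrightarrow> y + int d \<le> a"
    using Min_in[OF fin ne] Min_le[OF fin] by (auto simp: y_def f)
  \<comment> \<open>The largest \<open>x\<close> for which \<open>y + x * int d\<close> does not
    pass the right end of the interval; it turns out to be \<open>F b m d\<close>.\<close>
  define n where "n = (b + int m - y) div int d"
  have n0: "n \<ge> 0"
    using f_in assms(1) by (auto simp: n_def M_def pos_imp_zdiv_nonneg_iff)
  have le_n: "x \<le> n \<longleftrightarrow> x * int d \<le> b + int m - y" for x
  proof
    assume "x \<le> n"
    then have "x * int d \<le> n * int d"
      by (simp add: mult_right_mono)
    also have "\<dots> \<le> b + int m - y"
      using pos_mod_sign[of "int d" "b + int m - y"] assms(1)
      by (simp add: n_def minus_mod_eq_div_mult[symmetric])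
    finally show "x * int d \<le> b + int m - y" .
  next
    assume "x * int d \<le> b + int m - y"
    then show "x \<le> n"
      using zdiv_mono1[of "x * int d" "b + int m - y" "int d"] assms(1) by (simp add: n_def)
  qed
  have M_img: "M = (\<lambda>x. y + x * int d) ` {1..n}"
  proof (intro equalityI subsetI)
    fix a assume a: "a \<in> M"
    have "int d dvd a - (y + int d)"
      using a f_in by (auto simp: M_def)
    then obtain e where e: "a - (y + int d) = int d * e"
      by (elim dvdE)
    \<comment> \<open>Minimality of \<open>y + int d\<close> excludes multiples to its left.\<close>
    have "int d * e \<ge> 0"
      using f_le[OF a] e by simp
    then have "e \<ge> 0"
      using assms(1) by (simp add: zero_le_mult_iff)
    moreover have "(e + 1) * int d \<le> b + int m - y"
      using a e by (auto simp: M_def algebra_simps)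
    then have "e + 1 \<le> n"
      by (simp add: le_n)
    ultimately show "a \<in> (\<lambda>x. y + x * int d) ` {1..n}"
      using e by (intro image_eqI[of _ _ "e + 1"]) (auto simp: algebra_simps)
  next
    fix a assume "a \<in> (\<lambda>x. y + x * int d) ` {1..n}"
    then obtain x where x: "a = y + x * int d" "1 \<le> x" "x \<le> n"
      by (elim imageE) (simp only: atLeastAtMost_iff)
    have "int d \<le> x * int d"
      using x(2) by (simp add: mult_le_cancel_right1)
    moreover have "x * int d \<le> b + int m - y"
      using x(3) by (simp add: le_n)
    moreover have "int d dvd y"
      using f_in by (simp add: M_def)
    ultimately show "a \<in> M"
      using f_in x(1) by (auto simp: M_def)
  qed
  have "inj_on (\<lambda>x. y + x * int d) {1..n}"
    using assms(1) by (auto simp: inj_on_def)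
  then have "int (card M) = n"
    using n0 by (simp add: M_img card_image)
  then show ?thesis
    using M_img by (simp add: card M_def)
qed

text \<open>Both sides count the same index set \<open>?X\<close>: one through
  \<open>x \<mapsto> y + x * int d\<close>, the other through translation by \<open>c\<close>, and
  the gcd condition on \<open>c\<close> matches the two.\<close>

lemma phi_admissible_shift:
  assumes "admissible_shift b m i j c"
  defines "d \<equiv> nth_prime i * nth_prime j"
  shows "phi c (F b m d) (i - 1) =
    card {a. b < a \<and> a \<le> b + int m \<and> int d dvd a \<and> gcd a (int (primorial (i - 1))) = 1}"
    (is "_ = card ?A")
proof (cases "F b m d \<ge> 1")
  case True
  define y where "y = first_multiple b m d - int d"
  define P where "P = int (primorial (i - 1))"
  have d: "d > 0"
    using prime_nth_prime by (simp add: d_def prime_gt_0_nat)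
  have shift: "gcd (c + x) P = gcd (y + x * int d) P" for x
    using assms(1) True unfolding admissible_shift_def Let_def P_def y_def d_def by blast
  let ?X = "{x \<in> {1..int (F b m d)}. gcd (c + x) P = 1}"
  have "?A = {a. b < a \<and> a \<le> b + int m \<and> int d dvd a} \<inter> {a. gcd a P = 1}"
    by (auto simp: P_def)
  also have "\<dots> = (\<lambda>x. y + x * int d) ` ?X"
    unfolding multiples_eq_image[OF d True] y_def[symmetric] by (auto simp: shift)
  finally have "card ?A = card ?X"
    using d by (simp add: card_image inj_on_def)
  moreover have "{a. c < a \<and> a \<le> c + int (F b m d) \<and> gcd a P = 1} = (+) c ` ?X"
    (is "?L = _")
  proof (intro equalityI subsetI)
    fix a assume "a \<in> ?L"
    then show "a \<in> (+) c ` ?X"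
      by (intro image_eqI[of _ _ "a - c"]) auto
  qed auto
  then have "phi c (F b m d) (i - 1) = card ?X"
    unfolding phi_def P_def[symmetric] by (simp add: card_image)
  ultimately show ?thesis
    by simp
next
  case False
  \<comment> \<open>Admissibility says nothing about \<open>c\<close> here, but both counts are over
    empty sets.\<close>
  then have F0: "F b m d = 0"
    by simp
  have "finite {a. b < a \<and> a \<le> b + int m \<and> int d dvd a}"
    by (rule finite_subset[of _ "{b..b + int m}"]) auto
  then have "{a. b < a \<and> a \<le> b + int m \<and> int d dvd a} = {}"
    using F0 by (simp add: F_def)
  then have "?A = {}"
    by blast
  moreover have "phi c 0 (i - 1) = 0"
    unfolding phi_def by (rule card_eq_0_iff[THEN iffD2]) auto
  ultimately show ?thesis
    using F0 by (simp only: card.empty)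
qed

theorem theorem3p4:
  fixes b :: int and m k :: nat and c :: "nat \<Rightarrow> int"
  assumes "k \<ge> 1"
    and "\<And>i j. 2 \<le> i \<Longrightarrow> i < j \<Longrightarrow> j \<le> k \<Longrightarrow>
           admissible_shift b m i j (c (nth_prime i * nth_prime j))"
  shows "int (phi b m k) =
           int m
           - (\<Sum>i = 1..k. int (F b m (nth_prime i)))
           + (\<Sum>j = 2..k. int (F b m (2 * nth_prime j)))
           + (\<Sum>i = 2..k - 1. \<Sum>j = i + 1..k.
                int (phi (c (nth_prime i * nth_prime j)) (F b m (nth_prime i * nth_prime j)) (i - 1)))"
proof -
  define S where "S = {b<..b + int m}"
  define q where "q = (\<lambda>a i. of_bool (int (nth_prime i) dvd a) :: int)"
  define z where "z = (\<lambda>a t. \<Prod>l = 1..t. 1 - q a l)"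
  define G where "G = (\<lambda>i j. \<Sum>a\<in>S. q a i * q a j * z a (i - 1))"
  have z_eq: "z a t = of_bool (gcd a (int (primorial t)) = 1)" for a t
    by (simp add: z_def q_def of_bool_coprime_primorial)
  have card_sum: "int (card {a. b < a \<and> a \<le> b + int m \<and> Q a}) = (\<Sum>a\<in>S. of_bool (Q a))" for Q
  proof -
    have "{a. b < a \<and> a \<le> b + int m \<and> Q a} = S \<inter> {a. Q a}"
      by (auto simp: S_def)
    then show ?thesis
      by (simp add: S_def sum_of_bool_eq)
  qed
  have G_eq: "G i j = int (card {a. b < a \<and> a \<le> b + int m \<and>
      int (nth_prime i * nth_prime j) dvd a \<and> gcd a (int (primorial (i - 1))) = 1})"
    if "1 \<le> i" "i < j" for i j
    unfolding card_sum G_def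
    by (intro sum.cong refl) (simp only: nth_prime_mult_dvd_iff[OF that] z_eq q_def, simp)
  \<comment> \<open>For \<open>i = 1\<close> the coprimality condition is vacuous,
    \<open>primorial 0\<close> being the empty product 1.\<close>
  have G_first: "G 1 j = int (F b m (2 * nth_prime j))" if "2 \<le> j" for j
    using G_eq[of 1 j] that by (simp add: nth_prime_1[simplified] primorial_def F_def)
  have G_rest: "G i j = int (phi (c (nth_prime i * nth_prime j)) (F b m (nth_prime i * nth_prime j)) (i - 1))"
    if "2 \<le> i" "i < j" "j \<le> k" for i j
    using phi_admissible_shift[OF assms(2)[OF that]] G_eq[of i j] that by simp
  have "int (phi b m k) = (\<Sum>a\<in>S. z a k)"
    unfolding phi_def card_sum z_eq ..
  also have "\<dots> = (\<Sum>a\<in>S. 1 - (\<Sum>i = 1..k. q a i)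
                    + (\<Sum>i = 1..k. \<Sum>j = i + 1..k. q a i * q a j * z a (i - 1)))"
    unfolding z_def by (intro sum.cong refl prod_one_minus_expand)
  also have "\<dots> = int m - (\<Sum>a\<in>S. \<Sum>i = 1..k. q a i)
                    + (\<Sum>a\<in>S. \<Sum>i = 1..k. \<Sum>j = i + 1..k. q a i * q a j * z a (i - 1))"
    by (simp add: sum.distrib sum_subtractf S_def)
  also have "(\<Sum>a\<in>S. \<Sum>i = 1..k. q a i) = (\<Sum>i = 1..k. int (F b m (nth_prime i)))"
    unfolding F_def card_sum q_def by (rule sum.swap)
  also have "(\<Sum>a\<in>S. \<Sum>i = 1..k. \<Sum>j = i + 1..k. q a i * q a j * z a (i - 1))
      = (\<Sum>i = 1..k. \<Sum>j = i + 1..k. G i j)"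
    unfolding G_def by (subst sum.swap, intro sum.cong refl, rule sum.swap)
  also have "\<dots> = (\<Sum>j = 2..k. G 1 j) + (\<Sum>i = 2..k. \<Sum>j = i + 1..k. G i j)"
    using assms(1) by (simp add: sum.atLeast_Suc_atMost numeral_2_eq_2)
  also have "(\<Sum>j = 2..k. G 1 j) = (\<Sum>j = 2..k. int (F b m (2 * nth_prime j)))"
    by (intro sum.cong refl G_first) simp
  \<comment> \<open>The index \<open>i = k\<close> may be dropped, since no \<open>j\<close>
    satisfies \<open>k < j \<le> k\<close>.\<close>
  also have "(\<Sum>i = 2..k. \<Sum>j = i + 1..k. G i j) = (\<Sum>i = 2..k - 1. \<Sum>j = i + 1..k. G i j)"
    by (rule sum.mono_neutral_right) auto
  also have "\<dots> = (\<Sum>i = 2..k - 1. \<Sum>j = i + 1..k.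
                int (phi (c (nth_prime i * nth_prime j)) (F b m (nth_prime i * nth_prime j)) (i - 1)))"
    by (intro sum.cong refl G_rest) auto
  finally show ?thesis
    by (simp only: add.assoc)
qed

end
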